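(* Let $(X,T)$ be a topological flow with $T$ abelian. If $(X,T)$ is proximal, then $(E(X),T)$ is proximal. Further, if $(X,T)$ is point transitive, then the converse is also true: if $(E(X),T)$ is proximal, then $(X,T)$ is proximal.
   Context: A (topological) flow $(X,T)$ consists of a compact Hausdorff space $X$, a topological group $T$, and a continuous map $\pi:T\times X\to X$, written $\pi(t,x)=tx$, with $(st)x=s(tx)$ and such that each $\pi^t:X\to X$, $\pi^t(x)=tx$, is a homeomorphism (so the identity of $T$ acts as the identity map). Standing assumption: the space $X$ of the given flow has no isolated points (this is not required of $E(X)$). The enveloping semigroup is $E(X)=\overline{\{\pi^t: t\in T\}}\subseteq X^X$, the closure being taken in the product topology; $T$ acts on the compact Hausdorff space $E(X)$ by $t\cdot p=\pi^t\circ p$, giving the induced flow $(E(X),T)$. For any compact Hausdorff space $Y$ with a continuous action of $T$, let $\mathcal{U}_Y$ be the unique uniformity compatible with the topology of $Y$. A pair $(x,y)\in Y\times Y$ is proximal if for every $U\in\mathcal{U}_Y$ there is $t\in T$ with $(tx,ty)\in U$; $(Y,T)$ is proximal if every pair in $Y\times Y$ is proximal. $(Y,T)$ is point transitive if some $x\in Y$ has dense orbit $Tx=\{tx:t\in T\}$. *)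

theory Defs
  imports "HOL-Analysis.Analysis" "HOL-Algebra.Group"
begin

text \<open>Otherwise ambiguous with the topological \<^const>\<open>closure_of\<close>.\<close>
no_notation eq_closure_of (\<open>closure'_of\<index>\<close>)

section \<open>Uniformities on a carrier set\<close>

text \<open>
  Relativisation of the class \<^class>\<open>uniform_space\<close> to a carrier set \<open>S\<close>: the entourages are
  the sets \<open>U \<subseteq> S \<times> S\<close> such that \<open>\<forall>\<^sub>F p in F. p \<in> U\<close>. For \<open>S = {}\<close> the only uniformity is
  \<open>bot\<close>, whose only entourage is the empty set.
\<close>

definition uniform_structure :: "'a set \<Rightarrow> ('a \<times> 'a) filter \<Rightarrow> bool" where
  "uniform_structure S F \<longleftrightarrow>
     F \<le> principal (S \<times> S) \<and>
     (\<forall>E. eventually E F \<longrightarrow> (\<forall>x\<in>S. E (x, x))) \<and>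
     (\<forall>E. eventually E F \<longrightarrow> (\<forall>\<^sub>F (x, y) in F. E (y, x))) \<and>
     (\<forall>E. eventually E F \<longrightarrow>
        (\<exists>D. eventually D F \<and> (\<forall>x y z. D (x, y) \<longrightarrow> D (y, z) \<longrightarrow> E (x, z))))"

definition compatible_uniformity :: "'a topology \<Rightarrow> ('a \<times> 'a) filter \<Rightarrow> bool" where
  "compatible_uniformity Y F \<longleftrightarrow>
     uniform_structure (topspace Y) F \<and>
     (\<forall>A \<subseteq> topspace Y. openin Y A \<longleftrightarrow> (\<forall>x\<in>A. \<forall>\<^sub>F (x', y) in F. x' = x \<longrightarrow> y \<in> A))"

text \<open>
  Meaningful only when \<open>Y\<close> has exactly one compatible uniformity, in particular for compact
  Hausdorff \<open>Y\<close>; see \<open>compatible_uniformity_unique\<close> below.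
\<close>

definition uniformity_of :: "'a topology \<Rightarrow> ('a \<times> 'a) filter" where
  "uniformity_of Y = (THE F. compatible_uniformity Y F)"

lemma compatible_uniformityD:
  assumes "compatible_uniformity Y F"
  shows "\<forall>\<^sub>F p in F. p \<in> topspace Y \<times> topspace Y"
    and "\<And>E x. eventually E F \<Longrightarrow> x \<in> topspace Y \<Longrightarrow> E (x, x)"
    and "\<And>E. eventually E F \<Longrightarrow> (\<forall>\<^sub>F (x, y) in F. E (y, x))"
    and "\<And>E. eventually E F \<Longrightarrow>
        \<exists>D. eventually D F \<and> (\<forall>x y z. D (x, y) \<longrightarrow> D (y, z) \<longrightarrow> E (x, z))"
    and "\<And>A. A \<subseteq> topspace Y \<Longrightarrow>
        openin Y A \<longleftrightarrow> (\<forall>x\<in>A. \<forall>\<^sub>F (x', y) in F. x' = x \<longrightarrow> y \<in> A)"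
proof -
  note u = assms[unfolded compatible_uniformity_def uniform_structure_def le_principal]
  note v = u[THEN conjunct1]
  show "\<forall>\<^sub>F p in F. p \<in> topspace Y \<times> topspace Y" by (rule v[THEN conjunct1])
  show "\<And>E x. eventually E F \<Longrightarrow> x \<in> topspace Y \<Longrightarrow> E (x, x)"
    by (rule v[THEN conjunct2, THEN conjunct1, THEN spec, THEN mp, THEN bspec])
  show "\<And>E. eventually E F \<Longrightarrow> (\<forall>\<^sub>F (x, y) in F. E (y, x))"
    by (rule v[THEN conjunct2, THEN conjunct2, THEN conjunct1, THEN spec, THEN mp])
  show "\<And>E. eventually E F \<Longrightarrow>
        \<exists>D. eventually D F \<and> (\<forall>x y z. D (x, y) \<longrightarrow> D (y, z) \<longrightarrow> E (x, z))"
    by (rule v[THEN conjunct2, THEN conjunct2, THEN conjunct2, THEN spec, THEN mp])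
  show "\<And>A. A \<subseteq> topspace Y \<Longrightarrow>
        openin Y A \<longleftrightarrow> (\<forall>x\<in>A. \<forall>\<^sub>F (x', y) in F. x' = x \<longrightarrow> y \<in> A)"
    by (rule u[THEN conjunct2, THEN spec, THEN mp])
qed

lemma openin_prod_diagonal:
  assumes "openin (prod_topology Y Y) W" "(x, x) \<in> W"
  obtains U where "openin Y U" "x \<in> U" "U \<times> U \<subseteq> W"
proof -
  have "\<exists>U V. openin Y U \<and> openin Y V \<and> x \<in> U \<and> x \<in> V \<and> U \<times> V \<subseteq> W"
    by (rule assms(1)[unfolded openin_prod_topology_alt, THEN spec, THEN spec, THEN mp, OF assms(2)])
  then obtain U V where "openin Y U" "openin Y V" "x \<in> U" "x \<in> V" "U \<times> V \<subseteq> W"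
    by (elim exE conjE)
  then show ?thesis by (intro that[of "U \<inter> V"]) auto
qed

lemma uniform_structure_nhd:
  assumes F: "compatible_uniformity Y F" and x: "x \<in> topspace Y" and E: "eventually E F"
  obtains V where "openin Y V" "x \<in> V" "\<And>y. y \<in> V \<Longrightarrow> E (x, y)"
proof -
  note F1 = compatible_uniformityD(1)[OF F] and refl = compatible_uniformityD(2)[OF F]
    and trans = compatible_uniformityD(4)[OF F] and top = compatible_uniformityD(5)[OF F]
  define V where "V = {y \<in> topspace Y. \<forall>\<^sub>F (y', z) in F. y' = y \<longrightarrow> E (x, z)}"
  have "\<forall>\<^sub>F (y', z) in F. y' = y \<longrightarrow> z \<in> V" if "y \<in> V" for y
  proof -
    from that have "\<forall>\<^sub>F (y', z) in F. y' = y \<longrightarrow> E (x, z)" by (simp add: V_def)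
    from trans[OF this] obtain D where D: "eventually D F"
      "\<And>a b c. D (a, b) \<Longrightarrow> D (b, c) \<Longrightarrow> a = y \<Longrightarrow> E (x, c)" by auto
    show ?thesis using D(1) F1
    proof eventually_elim
      case (elim p)
      obtain a b where p: "p = (a, b)" by force
      have "\<forall>\<^sub>F (y', z) in F. y' = b \<longrightarrow> E (x, z)" if "a = y"
        using D(1) by eventually_elim (use D(2) elim(1) that p in auto)
      then show ?case using elim p by (auto simp: V_def)
    qed
  qed
  then have "openin Y V" by (subst top) (auto simp: V_def)
  moreover have "x \<in> V" using x E by (auto simp: V_def elim!: eventually_mono)
  moreover have "E (x, y)" if "y \<in> V" for y
    using that refl[of "\<lambda>(y', z). y' = y \<longrightarrow> E (x, z)" y] by (auto simp: V_def)
  ultimately show ?thesis using that by blast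
qed

lemma compatible_uniformity_eventually:
  assumes F: "compatible_uniformity Y F" and Y: "compact_space Y"
  shows "eventually E F \<longleftrightarrow>
    (\<exists>W. openin (prod_topology Y Y) W \<and> (\<forall>x\<in>topspace Y. (x, x) \<in> W) \<and> (\<forall>p\<in>W. E p))"
proof
  note F1 = compatible_uniformityD(1)[OF F] and refl = compatible_uniformityD(2)[OF F]
    and sym = compatible_uniformityD(3)[OF F] and trans = compatible_uniformityD(4)[OF F]
    and top = compatible_uniformityD(5)[OF F]
  { assume "eventually E F"
    from trans[OF this] obtain D where D: "eventually D F"
      "\<And>a b c. D (a, b) \<Longrightarrow> D (b, c) \<Longrightarrow> E (a, c)" by blast
    have "eventually (\<lambda>(a, b). D (a, b) \<and> D (b, a)) F"
      using D(1) sym[OF D(1)] by eventually_elim auto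
    then have "\<exists>V. openin Y V \<and> x \<in> V \<and> (\<forall>y\<in>V. D (x, y) \<and> D (y, x))"
      if "x \<in> topspace Y" for x
      using uniform_structure_nhd[OF F that] by (smt (verit, best) case_prod_conv)
    then obtain V where V: "\<And>x. x \<in> topspace Y \<Longrightarrow> openin Y (V x)"
      "\<And>x. x \<in> topspace Y \<Longrightarrow> x \<in> V x"
      "\<And>x y. x \<in> topspace Y \<Longrightarrow> y \<in> V x \<Longrightarrow> D (x, y) \<and> D (y, x)" by metis
    show "\<exists>W. openin (prod_topology Y Y) W \<and> (\<forall>x\<in>topspace Y. (x, x) \<in> W) \<and> (\<forall>p\<in>W. E p)"
    proof (intro exI[of _ "\<Union>x\<in>topspace Y. V x \<times> V x"] conjI)
      show "openin (prod_topology Y Y) (\<Union>x\<in>topspace Y. V x \<times> V x)"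
        using V(1) by (intro openin_Union) (auto simp: openin_prod_Times_iff)
    qed (use V D(2) in blast)+ }
  { assume "\<exists>W. openin (prod_topology Y Y) W \<and> (\<forall>x\<in>topspace Y. (x, x) \<in> W) \<and> (\<forall>p\<in>W. E p)"
    then obtain W where W: "openin (prod_topology Y Y) W" "\<forall>x\<in>topspace Y. (x, x) \<in> W" "\<forall>p\<in>W. E p"
      by blast
    define Q where "Q x U D V \<longleftrightarrow> U \<times> U \<subseteq> W \<and> eventually D F \<and> openin Y V \<and> x \<in> V \<and>
        (\<forall>y\<in>V. y \<in> U \<and> (\<forall>z. D (y, z) \<longrightarrow> z \<in> U))" for x U D V
    have "\<exists>U D V. Q x U D V" if x: "x \<in> topspace Y" for x
    proof -
      obtain U where U: "openin Y U" "x \<in> U" "U \<times> U \<subseteq> W"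
        using W(2) x by (blast intro: openin_prod_diagonal[OF W(1)])
      have "\<forall>\<^sub>F (x', y) in F. x' = x \<longrightarrow> y \<in> U"
        using top[of U] U openin_subset by blast
      from trans[OF this] obtain D where D: "eventually D F"
        "\<And>b c. D (x, b) \<Longrightarrow> D (b, c) \<Longrightarrow> c \<in> U" by auto
      obtain V where V: "openin Y V" "x \<in> V" "\<And>y. y \<in> V \<Longrightarrow> D (x, y)"
        using uniform_structure_nhd[OF F x D(1)] by blast
      have "y \<in> U" if "y \<in> V" for y
        using V that D refl[OF D(1), of y] openin_subset by blast
      moreover have "z \<in> U" if "y \<in> V" "D (y, z)" for y z
        using V(3)[OF that(1)] that(2) by (rule D(2))
      ultimately show ?thesis
        unfolding Q_def using U(3) V(1,2) D(1) by (intro exI[of _ U] exI[of _ D] exI[of _ V]) simp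
    qed
    then obtain U D V where Q: "\<And>x. x \<in> topspace Y \<Longrightarrow> Q x (U x) (D x) (V x)" by metis
    have UDV: "\<And>x. x \<in> topspace Y \<Longrightarrow> U x \<times> U x \<subseteq> W"
      "\<And>x. x \<in> topspace Y \<Longrightarrow> eventually (D x) F"
      "\<And>x. x \<in> topspace Y \<Longrightarrow> openin Y (V x)"
      "\<And>x. x \<in> topspace Y \<Longrightarrow> x \<in> V x"
      "\<And>x y. x \<in> topspace Y \<Longrightarrow> y \<in> V x \<Longrightarrow> y \<in> U x"
      "\<And>x y z. x \<in> topspace Y \<Longrightarrow> y \<in> V x \<Longrightarrow> D x (y, z) \<Longrightarrow> z \<in> U x"
      using Q by (simp_all add: Q_def)
    have "\<exists>\<F>. finite \<F> \<and> \<F> \<subseteq> V ` topspace Y \<and> topspace Y \<subseteq> \<Union>\<F>"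
      using Y UDV(3,4) by (intro compactinD[of Y "topspace Y" "V ` topspace Y"])
        (auto simp: compact_space_def)
    then obtain I where I: "finite I" "I \<subseteq> topspace Y" "topspace Y \<subseteq> (\<Union>i\<in>I. V i)"
      by (metis finite_subset_image)
    have "eventually (\<lambda>p. \<forall>i\<in>I. D i p) F"
      using I UDV(2) by (intro eventually_ball_finite) auto
    then show "eventually E F" using F1
    proof eventually_elim
      case (elim p)
      obtain y z where p: "p = (y, z)" by force
      then obtain i where "i \<in> I" "y \<in> V i" using elim I by blast
      then have "y \<in> U i" "z \<in> U i" using UDV(5,6) I(2) elim(1) p by blast+
      then show ?case using UDV(1) \<open>i \<in> I\<close> I(2) W(3) p by blast
    qed }
qed

lemma compact_Hausdorff_diagonal_refinement:
  assumes Y: "compact_space Y" "Hausdorff_space Y"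
    and W: "openin (prod_topology Y Y) W" "\<forall>x\<in>topspace Y. (x, x) \<in> W"
  obtains D where "openin (prod_topology Y Y) D" "\<forall>x\<in>topspace Y. (x, x) \<in> D"
    "\<And>x y z. (x, y) \<in> D \<Longrightarrow> (y, z) \<in> D \<Longrightarrow> (x, z) \<in> W"
proof -
  have reg: "regular_space Y" using Y by (simp add: compact_Hausdorff_imp_regular_space)
  define Q where "Q x U V C \<longleftrightarrow>
      U \<times> U \<subseteq> W \<and> openin Y U \<and> openin Y V \<and> closedin Y C \<and> x \<in> V \<and> V \<subseteq> C \<and> C \<subseteq> U" for x U V C
  have "\<exists>U V C. Q x U V C"
    if x: "x \<in> topspace Y" for x
  proof -
    obtain U where U: "openin Y U" "x \<in> U" "U \<times> U \<subseteq> W"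
      using W(2) x by (blast intro: openin_prod_diagonal[OF W(1)])
    have "\<exists>V C. openin Y V \<and> closedin Y C \<and> x \<in> V \<and> V \<subseteq> C \<and> C \<subseteq> U"
      using reg U unfolding neighbourhood_base_of_closedin[symmetric] neighbourhood_base_of by metis
    then show ?thesis unfolding Q_def using U by blast
  qed
  then obtain U V C where Q: "\<And>x. x \<in> topspace Y \<Longrightarrow> Q x (U x) (V x) (C x)" by metis
  have UVC: "\<And>x. x \<in> topspace Y \<Longrightarrow> U x \<times> U x \<subseteq> W"
    "\<And>x. x \<in> topspace Y \<Longrightarrow> openin Y (U x)"
    "\<And>x. x \<in> topspace Y \<Longrightarrow> openin Y (V x)"
    "\<And>x. x \<in> topspace Y \<Longrightarrow> closedin Y (C x)"
    "\<And>x. x \<in> topspace Y \<Longrightarrow> x \<in> V x"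
    "\<And>x. x \<in> topspace Y \<Longrightarrow> V x \<subseteq> C x"
    "\<And>x. x \<in> topspace Y \<Longrightarrow> C x \<subseteq> U x"
    using Q by (simp_all add: Q_def)
  have "\<exists>\<F>. finite \<F> \<and> \<F> \<subseteq> V ` topspace Y \<and> topspace Y \<subseteq> \<Union>\<F>"
    using Y UVC(3,5) by (intro compactinD[of Y "topspace Y" "V ` topspace Y"])
      (auto simp: compact_space_def)
  then obtain I where I: "finite I" "I \<subseteq> topspace Y" "topspace Y \<subseteq> (\<Union>i\<in>I. V i)"
    by (metis finite_subset_image)
  define B where "B i = U i \<times> U i \<union> (topspace Y - C i) \<times> (topspace Y - C i)" for i
  define D where "D = topspace (prod_topology Y Y) \<inter> (\<Inter>i\<in>I. B i)"
  show ?thesis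
  proof
    have "openin (prod_topology Y Y) (B i)" if "i \<in> I" for i
      using UVC(2,4)[of i] that I(2) unfolding B_def
      by (intro openin_Un) (auto simp: openin_prod_Times_iff)
    then show "openin (prod_topology Y Y) D"
      unfolding D_def
      using I(1) openin_topspace by (intro openin_Int_Inter) blast+
    show "\<forall>x\<in>topspace Y. (x, x) \<in> D"
      using UVC(7) I(2) by (auto simp: D_def B_def)
    fix x y z assume "(x, y) \<in> D" "(y, z) \<in> D"
    then obtain i where i: "i \<in> I" "y \<in> V i" "(x, y) \<in> B i" "(y, z) \<in> B i"
      using I(3) by (auto simp: D_def)
    then have "x \<in> U i" "z \<in> U i" using UVC(6) I(2) by (auto simp: B_def)
    then show "(x, z) \<in> W" using UVC(1) i I(2) by blast
  qed
qed

lemma compatible_uniformity_unique: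
  assumes Y: "compact_space Y" "Hausdorff_space Y"
  shows "\<exists>!F. compatible_uniformity Y F"
proof (rule ex_ex1I)
  define \<W> where "\<W> = {W. openin (prod_topology Y Y) W \<and> (\<forall>x\<in>topspace Y. (x, x) \<in> W)}"
  define N where "N = (INF W\<in>\<W>. principal W)"
  have top: "topspace Y \<times> topspace Y \<in> \<W>"
    by (simp add: \<W>_def openin_prod_Times_iff)
  have ev: "eventually P N \<longleftrightarrow> (\<exists>W\<in>\<W>. \<forall>p\<in>W. P p)" for P
    unfolding N_def
  proof (subst eventually_INF_base)
    show "\<W> \<noteq> {}" using top by auto
    show "\<exists>x\<in>\<W>. principal x \<le> inf (principal a) (principal b)" if "a \<in> \<W>" "b \<in> \<W>" for a b
      using that by (intro bexI[of _ "a \<inter> b"]) (auto simp: \<W>_def)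
  qed (simp add: eventually_principal)
  have "uniform_structure (topspace Y) N"
    unfolding uniform_structure_def
  proof (intro conjI allI impI ballI)
    show "N \<le> principal (topspace Y \<times> topspace Y)"
      unfolding le_principal ev using top by blast
    show "E (x, x)" if "eventually E N" "x \<in> topspace Y" for E x
      using that unfolding ev by (auto simp: \<W>_def)
    show "\<forall>\<^sub>F (x, y) in N. E (y, x)" if E: "eventually E N" for E
    proof -
      obtain W where W: "W \<in> \<W>" "\<forall>p\<in>W. E p" using E ev by blast
      have "openin (prod_topology Y Y)
          {p \<in> topspace (prod_topology Y Y). (\<lambda>(x, y). (y, x)) p \<in> W}"
        using W(1) by (intro openin_continuous_map_preimage[where Y = "prod_topology Y Y"])
          (auto simp: \<W>_def continuous_map_pairwise o_def case_prod_beta continuous_map_fst continuous_map_snd)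
      then have "{p \<in> topspace (prod_topology Y Y). (\<lambda>(x, y). (y, x)) p \<in> W} \<in> \<W>"
        using W(1) by (auto simp: \<W>_def)
      then show ?thesis unfolding ev by (rule bexI[rotated]) (use W(2) in auto)
    qed
    show "\<exists>D. eventually D N \<and> (\<forall>x y z. D (x, y) \<longrightarrow> D (y, z) \<longrightarrow> E (x, z))"
      if E: "eventually E N" for E
    proof -
      obtain W where W: "openin (prod_topology Y Y) W" "\<forall>x\<in>topspace Y. (x, x) \<in> W" "\<forall>p\<in>W. E p"
        using E unfolding ev by (auto simp: \<W>_def)
      obtain D where D: "openin (prod_topology Y Y) D" "\<forall>x\<in>topspace Y. (x, x) \<in> D"
        "\<And>x y z. (x, y) \<in> D \<Longrightarrow> (y, z) \<in> D \<Longrightarrow> (x, z) \<in> W"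
        using compact_Hausdorff_diagonal_refinement[OF Y W(1,2)] by blast
      then have "eventually (\<lambda>p. p \<in> D) N" unfolding ev by (auto simp: \<W>_def)
      then show ?thesis using D(3) W(3) by (intro exI[of _ "\<lambda>p. p \<in> D"]) blast
    qed
  qed
  moreover have "openin Y A \<longleftrightarrow> (\<forall>x\<in>A. \<forall>\<^sub>F (x', y) in N. x' = x \<longrightarrow> y \<in> A)"
    if A: "A \<subseteq> topspace Y" for A
  proof (intro iffI ballI)
    fix x assume "openin Y A" "x \<in> A"
    moreover have "openin Y (topspace Y - {x})"
      using Y(2) A \<open>x \<in> A\<close> by (intro openin_diff closedin_Hausdorff_singleton) auto
    ultimately have "topspace Y \<times> A \<union> (topspace Y - {x}) \<times> topspace Y \<in> \<W>"
      using A by (auto simp: \<W>_def openin_prod_Times_iff intro!: openin_Un)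
    then show "\<forall>\<^sub>F (x', y) in N. x' = x \<longrightarrow> y \<in> A"
      unfolding ev by (rule bexI[rotated]) auto
  next
    assume *: "\<forall>x\<in>A. \<forall>\<^sub>F (x', y) in N. x' = x \<longrightarrow> y \<in> A"
    show "openin Y A"
    proof (subst openin_subopen, intro ballI)
      fix x assume x: "x \<in> A"
      then obtain W where W: "W \<in> \<W>" "\<forall>p\<in>W. case p of (x', y) \<Rightarrow> x' = x \<longrightarrow> y \<in> A"
        using * ev by blast
      have "(x, x) \<in> W" using W(1) x A by (auto simp: \<W>_def)
      then obtain U where "openin Y U" "x \<in> U" "U \<times> U \<subseteq> W"
        using W(1) by (auto simp: \<W>_def elim: openin_prod_diagonal)
      then show "\<exists>T. openin Y T \<and> x \<in> T \<and> T \<subseteq> A" using W(2) by (intro exI[of _ U]) auto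
    qed
  qed
  ultimately show "\<exists>F. compatible_uniformity Y F" unfolding compatible_uniformity_def by blast
next
  fix F G assume "compatible_uniformity Y F" "compatible_uniformity Y G"
  then show "F = G"
    by (intro filter_eq_iff[THEN iffD2] allI)
      (simp add: compatible_uniformity_eventually[OF _ Y(1)])
qed

section \<open>Flows\<close>

definition topological_group :: "('t, 'm) monoid_scheme \<Rightarrow> 't topology \<Rightarrow> bool" where
  "topological_group T \<tau> \<longleftrightarrow>
     group T \<and> topspace \<tau> = carrier T \<and>
     continuous_map (prod_topology \<tau> \<tau>) \<tau> (\<lambda>(s, t). s \<otimes>\<^bsub>T\<^esub> t) \<and>
     continuous_map \<tau> \<tau> (\<lambda>t. inv\<^bsub>T\<^esub> t)"

definition flow ::
  "('t, 'm) monoid_scheme \<Rightarrow> 't topology \<Rightarrow> 'a topology \<Rightarrow> ('t \<Rightarrow> 'a \<Rightarrow> 'a) \<Rightarrow> bool" where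
  "flow T \<tau> X \<pi> \<longleftrightarrow>
     topological_group T \<tau> \<and> compact_space X \<and> Hausdorff_space X \<and>
     continuous_map (prod_topology \<tau> X) X (\<lambda>(t, x). \<pi> t x) \<and>
     (\<forall>s\<in>carrier T. \<forall>t\<in>carrier T. \<forall>x\<in>topspace X. \<pi> (s \<otimes>\<^bsub>T\<^esub> t) x = \<pi> s (\<pi> t x)) \<and>
     (\<forall>t\<in>carrier T. homeomorphic_map X X (\<pi> t))"

definition proximal_pair ::
  "('t, 'm) monoid_scheme \<Rightarrow> 'a topology \<Rightarrow> ('t \<Rightarrow> 'a \<Rightarrow> 'a) \<Rightarrow> 'a \<Rightarrow> 'a \<Rightarrow> bool" where
  "proximal_pair T Y \<pi> x y \<longleftrightarrow>
     (\<forall>U. (\<forall>\<^sub>F p in uniformity_of Y. p \<in> U) \<longrightarrow> (\<exists>t\<in>carrier T. (\<pi> t x, \<pi> t y) \<in> U))"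

definition proximal_flow ::
  "('t, 'm) monoid_scheme \<Rightarrow> 'a topology \<Rightarrow> ('t \<Rightarrow> 'a \<Rightarrow> 'a) \<Rightarrow> bool" where
  "proximal_flow T Y \<pi> \<longleftrightarrow> (\<forall>x\<in>topspace Y. \<forall>y\<in>topspace Y. proximal_pair T Y \<pi> x y)"

definition point_transitive ::
  "('t, 'm) monoid_scheme \<Rightarrow> 'a topology \<Rightarrow> ('t \<Rightarrow> 'a \<Rightarrow> 'a) \<Rightarrow> bool" where
  "point_transitive T Y \<pi> \<longleftrightarrow>
     (\<exists>x\<in>topspace Y. Y closure_of ((\<lambda>t. \<pi> t x) ` carrier T) = topspace Y)"

section \<open>The enveloping semigroup\<close>

text \<open>
  The points of the product space \<open>X\<^sup>X\<close> are the extensional functions on \<^term>\<open>topspace X\<close>, so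
  the translations have to be restricted to \<^term>\<open>topspace X\<close>.
\<close>

definition enveloping_semigroup ::
  "('t, 'm) monoid_scheme \<Rightarrow> 'a topology \<Rightarrow> ('t \<Rightarrow> 'a \<Rightarrow> 'a) \<Rightarrow> ('a \<Rightarrow> 'a) set" where
  "enveloping_semigroup T X \<pi> =
     product_topology (\<lambda>_. X) (topspace X) closure_of
       ((\<lambda>t. restrict (\<pi> t) (topspace X)) ` carrier T)"

definition enveloping_space ::
  "('t, 'm) monoid_scheme \<Rightarrow> 'a topology \<Rightarrow> ('t \<Rightarrow> 'a \<Rightarrow> 'a) \<Rightarrow> ('a \<Rightarrow> 'a) topology" where
  "enveloping_space T X \<pi> =
     subtopology (product_topology (\<lambda>_. X) (topspace X)) (enveloping_semigroup T X \<pi>)"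

definition enveloping_action ::
  "'a topology \<Rightarrow> ('t \<Rightarrow> 'a \<Rightarrow> 'a) \<Rightarrow> 't \<Rightarrow> ('a \<Rightarrow> 'a) \<Rightarrow> 'a \<Rightarrow> 'a" where
  "enveloping_action X \<pi> t p = compose (topspace X) (\<pi> t) p"

text \<open>The induced action makes the enveloping semigroup a flow.\<close>

lemma flow_enveloping:
  assumes "flow T \<tau> X \<pi>"
  shows "flow T \<tau> (enveloping_space T X \<pi>) (enveloping_action X \<pi>)"
proof -
  let ?P = "product_topology (\<lambda>_. X) (topspace X)" and ?E = "enveloping_space T X \<pi>"
    and ?a = "enveloping_action X \<pi>" and ?tr = "\<lambda>t. restrict (\<pi> t) (topspace X)"
  have T: "topological_group T \<tau>" and cX: "compact_space X" and hX: "Hausdorff_space X"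
    and cont: "continuous_map (prod_topology \<tau> X) X (\<lambda>(t, x). \<pi> t x)"
    and act: "\<And>s t x. s \<in> carrier T \<Longrightarrow> t \<in> carrier T \<Longrightarrow> x \<in> topspace X \<Longrightarrow>
        \<pi> (s \<otimes>\<^bsub>T\<^esub> t) x = \<pi> s (\<pi> t x)"
    and homeo: "\<And>t. t \<in> carrier T \<Longrightarrow> homeomorphic_map X X (\<pi> t)"
    using assms by (auto simp: flow_def)
  interpret group T using T by (simp add: topological_group_def)
  have ct: "topspace \<tau> = carrier T" using T by (simp add: topological_group_def)
  have mapX: "\<pi> t x \<in> topspace X" if "t \<in> carrier T" "x \<in> topspace X" for t x
    using homeo[OF that(1)] that(2) by (auto simp: homeomorphic_eq_everything_map)
  have one: "\<pi> \<one>\<^bsub>T\<^esub> x = x" if x: "x \<in> topspace X" for x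
  proof -
    have "\<pi> \<one>\<^bsub>T\<^esub> (\<pi> \<one>\<^bsub>T\<^esub> x) = \<pi> \<one>\<^bsub>T\<^esub> x" using act[of "\<one>\<^bsub>T\<^esub>" "\<one>\<^bsub>T\<^esub>" x] x by simp
    moreover have "inj_on (\<pi> \<one>\<^bsub>T\<^esub>) (topspace X)"
      using homeo[of "\<one>\<^bsub>T\<^esub>"] by (simp add: homeomorphic_eq_everything_map)
    ultimately show ?thesis using x mapX[of "\<one>\<^bsub>T\<^esub>" x] by (simp add: inj_on_eq_iff)
  qed
  have Esub: "enveloping_semigroup T X \<pi> \<subseteq> topspace ?P"
    unfolding enveloping_semigroup_def by (rule closure_of_subset_topspace)
  then have topE: "topspace ?E = enveloping_semigroup T X \<pi>"
    by (auto simp: enveloping_space_def)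
  have ext: "p \<in> topspace X \<rightarrow>\<^sub>E topspace X" if "p \<in> enveloping_semigroup T X \<pi>" for p
    using Esub that by auto
  have contP: "continuous_map (prod_topology \<tau> ?P) ?P (\<lambda>(t, p). ?a t p)"
    unfolding continuous_map_componentwise
  proof (intro conjI ballI)
    show "(\<lambda>(t, p). ?a t p) ` topspace (prod_topology \<tau> ?P) \<subseteq> extensional (topspace X)"
      by (auto simp: enveloping_action_def compose_def)
    fix x assume x: "x \<in> topspace X"
    have "continuous_map (prod_topology \<tau> ?P) (prod_topology \<tau> X) (\<lambda>q. (fst q, snd q x))"
      using x by (auto simp: continuous_map_pairwise o_def continuous_map_fst
          intro: continuous_map_compose[OF continuous_map_snd continuous_map_product_projection,
              unfolded o_def])
    from continuous_map_compose[OF this cont]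
    show "continuous_map (prod_topology \<tau> ?P) X (\<lambda>q. (case q of (t, p) \<Rightarrow> ?a t p) x)"
      using x by (simp add: o_def case_prod_beta enveloping_action_def compose_def)
  qed
  have contPt: "continuous_map ?P ?P (?a t)" if t: "t \<in> carrier T" for t
  proof -
    have "continuous_map ?P (prod_topology \<tau> ?P) (\<lambda>p. (t, p))"
      using t ct by (simp add: continuous_map_pairwise o_def)
    from continuous_map_compose[OF this contP] show ?thesis by (simp add: o_def)
  qed
  have inv: "?a t p \<in> enveloping_semigroup T X \<pi>"
    if t: "t \<in> carrier T" and p: "p \<in> enveloping_semigroup T X \<pi>" for t p
  proof -
    have "?a t (?tr s) = ?tr (t \<otimes>\<^bsub>T\<^esub> s)" if "s \<in> carrier T" for s
      using act t that by (auto simp: enveloping_action_def compose_def fun_eq_iff)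
    then have "?a t ` ?tr ` carrier T \<subseteq> ?tr ` carrier T" using t by auto
    then have "?P closure_of (?a t ` ?tr ` carrier T) \<subseteq> enveloping_semigroup T X \<pi>"
      unfolding enveloping_semigroup_def by (rule closure_of_mono)
    moreover have "?a t p \<in> ?P closure_of (?a t ` ?tr ` carrier T)"
      using continuous_map_image_closure_subset[OF contPt[OF t], of "?tr ` carrier T"] p
      unfolding enveloping_semigroup_def by blast
    ultimately show ?thesis by blast
  qed
  have contE: "continuous_map (prod_topology \<tau> ?E) ?E (\<lambda>(t, p). ?a t p)"
  proof -
    have "prod_topology \<tau> ?E = subtopology (prod_topology \<tau> ?P) (topspace \<tau> \<times> enveloping_semigroup T X \<pi>)"
      unfolding enveloping_space_def by (simp add: prod_topology_subtopology(2))
    then have "continuous_map (prod_topology \<tau> ?E) ?P (\<lambda>(t, p). ?a t p)"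
      using contP by (simp add: continuous_map_from_subtopology)
    then show ?thesis
      unfolding enveloping_space_def continuous_map_in_subtopology
      using inv by (auto simp: ct topE[unfolded enveloping_space_def])
  qed
  have contEt: "continuous_map ?E ?E (?a t)" if t: "t \<in> carrier T" for t
  proof -
    have "continuous_map ?E (prod_topology \<tau> ?E) (\<lambda>p. (t, p))"
      using t ct by (simp add: continuous_map_pairwise o_def)
    from continuous_map_compose[OF this contE] show ?thesis by (simp add: o_def)
  qed
  have actE: "?a (s \<otimes>\<^bsub>T\<^esub> t) p = ?a s (?a t p)"
    if "s \<in> carrier T" "t \<in> carrier T" "p \<in> enveloping_semigroup T X \<pi>" for s t p
    using that act[OF that(1,2) PiE_mem[OF ext[OF that(3)]]]
    by (simp add: enveloping_action_def compose_def fun_eq_iff)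
  have oneE: "?a \<one>\<^bsub>T\<^esub> p = p" if "p \<in> enveloping_semigroup T X \<pi>" for p
  proof
    fix x show "?a \<one>\<^bsub>T\<^esub> p x = p x"
      using one[OF PiE_mem[OF ext[OF that]]] PiE_arb[OF ext[OF that]]
      by (cases "x \<in> topspace X") (simp_all add: enveloping_action_def compose_def)
  qed
  have homeoE: "homeomorphic_map ?E ?E (?a t)" if t: "t \<in> carrier T" for t
  proof -
    have "?a (inv\<^bsub>T\<^esub> t) (?a t p) = p" "?a t (?a (inv\<^bsub>T\<^esub> t) p) = p"
      if "p \<in> enveloping_semigroup T X \<pi>" for p
      using actE[of "inv\<^bsub>T\<^esub> t" t p] actE[of t "inv\<^bsub>T\<^esub> t" p] t that oneE[OF that] by simp_all
    then show ?thesis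
      unfolding homeomorphic_map_maps homeomorphic_maps_def
      by (intro exI[of _ "?a (inv\<^bsub>T\<^esub> t)"]) (simp add: topE contEt t)
  qed
  have "closedin ?P (enveloping_semigroup T X \<pi>)"
    unfolding enveloping_semigroup_def by (rule closedin_closure_of)
  moreover have "compact_space ?P" "Hausdorff_space ?P"
    using cX hX by (simp_all add: compact_space_product_topology Hausdorff_space_product_topology)
  ultimately have "compact_space ?E" "Hausdorff_space ?E"
    unfolding enveloping_space_def
    by (simp_all add: closedin_compact_space compact_space_subtopology Hausdorff_space_subtopology)
  then show ?thesis
    unfolding flow_def using T contE actE homeoE by (simp add: topE)
qed

end

theory Submission
  imports Defs
begin

text \<open>
  A pair is proximal iff some element of the enveloping semigroup \<open>E\<close> identifies its two points.
  If \<open>T\<close> is abelian and \<open>X\<close> is proximal, an \<open>r\<close> identifying \<open>z\<close> and \<open>tz\<close> makes \<open>rz\<close> a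
  fixed point of \<open>t\<close>, and compactness yields a common fixed point \<open>z\<close> of \<open>T\<close>. Every point is
  identified with \<open>z\<close>, hence sent to \<open>z\<close>, by some element of \<open>E\<close>; composing such elements and
  using compactness of \<open>E\<close>, the constant map \<open>z\<close> lies in \<open>E\<close>, and it identifies all elements of
  \<open>E\<close>. Conversely, evaluation at a point with dense orbit maps \<open>E\<close> onto \<open>X\<close> equivariantly.
\<close>

section \<open>Compactness tools\<close>

text \<open>On a compact Hausdorff space the entourages are exactly the sets containing an open
  neighbourhood of the diagonal. From here on uniformities can be forgotten.\<close>

lemma proximal_pair_iff_open:
  assumes Y: "compact_space Y" "Hausdorff_space Y"
  shows "proximal_pair T Y \<pi> x y \<longleftrightarrow>
    (\<forall>W. openin (prod_topology Y Y) W \<longrightarrow> (\<forall>a\<in>topspace Y. (a, a) \<in> W) \<longrightarrow>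
      (\<exists>t\<in>carrier T. (\<pi> t x, \<pi> t y) \<in> W))"
proof -
  have F: "compatible_uniformity Y (uniformity_of Y)"
    unfolding uniformity_of_def by (rule theI'[OF compatible_uniformity_unique[OF Y]])
  show ?thesis
    unfolding proximal_pair_def compatible_uniformity_eventually[OF F Y(1)] by blast
qed

text \<open>The finite intersection property, phrased as solving a family of closed conditions
  inside \<open>K\<close>. It will yield a common fixed point in \<open>X\<close> and a constant map
  in \<open>E\<close>.\<close>

lemma compactin_finite_intersections:
  assumes "compactin Y K" "\<And>i. i \<in> I \<Longrightarrow> closedin Y (C i)"
    and "\<And>J. finite J \<Longrightarrow> J \<subseteq> I \<Longrightarrow> \<exists>y\<in>K. \<forall>i\<in>J. y \<in> C i"
  shows "\<exists>y\<in>K. \<forall>i\<in>I. y \<in> C i"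
proof -
  have "K \<inter> \<Inter>\<F> \<noteq> {}" if \<F>: "finite \<F>" "\<F> \<subseteq> C ` I" for \<F>
  proof -
    obtain J where "finite J" "J \<subseteq> I" "\<F> = C ` J" using finite_subset_image[OF \<F>] by metis
    then show ?thesis using assms(3)[of J] by blast
  qed
  moreover have "\<forall>D\<in>C ` I. closedin Y D" using assms(2) by blast
  ultimately have "K \<inter> \<Inter>(C ` I) \<noteq> {}"
    using assms(1)[unfolded compactin_fip, THEN conjunct2, THEN spec, of "C ` I"] by blast
  then show ?thesis by blast
qed

section \<open>The enveloping semigroup of a flow\<close>

locale topological_flow =
  fixes T :: "('t, 'm) monoid_scheme" and \<tau> :: "'t topology"
    and X :: "'a topology" and \<pi> :: "'t \<Rightarrow> 'a \<Rightarrow> 'a"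
  assumes flow: "flow T \<tau> X \<pi>"
begin

abbreviation P where "P \<equiv> product_topology (\<lambda>_. X) (topspace X)"
abbreviation E where "E \<equiv> enveloping_semigroup T X \<pi>"
abbreviation tr where "tr t \<equiv> restrict (\<pi> t) (topspace X)"

lemma compact_X: "compact_space X" and Hausdorff_X: "Hausdorff_space X"
  using flow by (simp_all add: flow_def)

lemma act_mult:
  "s \<in> carrier T \<Longrightarrow> t \<in> carrier T \<Longrightarrow> x \<in> topspace X \<Longrightarrow> \<pi> (s \<otimes>\<^bsub>T\<^esub> t) x = \<pi> s (\<pi> t x)"
  using flow by (simp add: flow_def)

lemma continuous_act: "t \<in> carrier T \<Longrightarrow> continuous_map X X (\<pi> t)"
  using flow by (simp add: flow_def homeomorphic_eq_everything_map)

lemma act_closed: "t \<in> carrier T \<Longrightarrow> x \<in> topspace X \<Longrightarrow> \<pi> t x \<in> topspace X"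
  using continuous_act by (auto simp: continuous_map_def)

lemma E_subset: "E \<subseteq> topspace P"
  unfolding enveloping_semigroup_def by (rule closure_of_subset_topspace)

lemma E_closed_pt: "r \<in> E \<Longrightarrow> x \<in> topspace X \<Longrightarrow> r x \<in> topspace X"
  using PiE_mem[of r "topspace X" "\<lambda>_. topspace X" x] subsetD[OF E_subset, of r] by simp

lemma topspace_enveloping: "topspace (enveloping_space T X \<pi>) = E"
  using E_subset by (auto simp: enveloping_space_def)

lemma tr_in_E: "t \<in> carrier T \<Longrightarrow> tr t \<in> E"
proof -
  have "(tr ` carrier T) \<subseteq> topspace P" using act_closed by auto
  then show "t \<in> carrier T \<Longrightarrow> tr t \<in> E"
    unfolding enveloping_semigroup_def using closure_of_subset by blast
qed

lemma compactin_E: "compactin P E"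
proof (rule closedin_compact_space)
  show "compact_space P" by (simp add: compact_space_product_topology compact_X)
  show "closedin P E" by (simp add: enveloping_semigroup_def)
qed

lemma flow_E: "flow T \<tau> (enveloping_space T X \<pi>) (enveloping_action X \<pi>)"
  by (rule flow_enveloping[OF flow])

lemma enveloping_action_in_E:
  assumes "t \<in> carrier T" "p \<in> E" shows "enveloping_action X \<pi> t p \<in> E"
proof -
  interpret E: topological_flow T \<tau> "enveloping_space T X \<pi>" "enveloping_action X \<pi>"
    by (rule topological_flow.intro[OF flow_E])
  show ?thesis using E.act_closed[OF assms(1)] assms(2) unfolding topspace_enveloping by blast
qed

lemma continuous_eval: "x \<in> topspace X \<Longrightarrow> continuous_map P X (\<lambda>r. r x)"
  by (rule continuous_map_product_projection)

text \<open>Translations are dense in \<open>E\<close>. This turns an element of \<open>E\<close>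
  with some open property into an actual group element with that property.\<close>

lemma E_meets_open:
  assumes "r \<in> E" "continuous_map P Z f" "openin Z W" "f r \<in> W"
  obtains t where "t \<in> carrier T" "f (tr t) \<in> W"
proof -
  have "openin P {r \<in> topspace P. f r \<in> W}"
    using assms(2,3) by (rule openin_continuous_map_preimage)
  moreover have "r \<in> {r \<in> topspace P. f r \<in> W}"
    using assms(1,4) E_subset by blast
  ultimately have "\<exists>q. q \<in> tr ` carrier T \<and> q \<in> {r \<in> topspace P. f r \<in> W}"
    using assms(1)[unfolded enveloping_semigroup_def in_closure_of] by meson
  then show ?thesis using that by blast
qed

text \<open>By density of the translations, since equalizers of continuous maps into a Hausdorff
  space are closed.\<close>

lemma E_eqI:
  assumes "r \<in> E" "continuous_map P X f" "continuous_map P X g"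
    and "\<And>t. t \<in> carrier T \<Longrightarrow> f (tr t) = g (tr t)"
  shows "f r = g r"
  by (rule forall_in_closure_of_eq[OF assms(1)[unfolded enveloping_semigroup_def]
        Hausdorff_X assms(2,3)]) (use assms(4) in blast)

text \<open>The image of the compact set \<open>E\<close> is closed and contains the orbit;
  continuity of evaluation gives the other inclusion.\<close>

lemma eval_E: "x \<in> topspace X \<Longrightarrow> (\<lambda>r. r x) ` E = X closure_of ((\<lambda>t. \<pi> t x) ` carrier T)"
proof
  assume x: "x \<in> topspace X"
  have "closedin X ((\<lambda>r. r x) ` E)"
    by (intro compactin_imp_closedin Hausdorff_X image_compactin[OF compactin_E] continuous_eval x)
  moreover have "(\<lambda>t. \<pi> t x) ` carrier T \<subseteq> (\<lambda>r. r x) ` E"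
  proof safe
    fix t assume "t \<in> carrier T"
    then show "\<pi> t x \<in> (\<lambda>r. r x) ` E"
      using x by (intro image_eqI[of _ _ "tr t"] tr_in_E) simp_all
  qed
  ultimately show "X closure_of ((\<lambda>t. \<pi> t x) ` carrier T) \<subseteq> (\<lambda>r. r x) ` E"
    by (simp add: closure_of_minimal)
  have "(\<lambda>r. r x) ` E \<subseteq> X closure_of ((\<lambda>r. r x) ` tr ` carrier T)"
    unfolding enveloping_semigroup_def
    by (rule continuous_map_image_closure_subset[OF continuous_eval[OF x]])
  then show "(\<lambda>r. r x) ` E \<subseteq> X closure_of ((\<lambda>t. \<pi> t x) ` carrier T)"
    using x by (simp add: image_image)
qed

text \<open>Coordinate \<open>x\<close> of the composite is evaluation of \<open>r\<close> at the
  point \<open>p x\<close>, hence continuous in \<open>r\<close>.\<close>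

lemma continuous_precompose:
  assumes "p \<in> E" shows "continuous_map P P (\<lambda>r. compose (topspace X) r p)"
  unfolding continuous_map_componentwise
proof (intro conjI ballI)
  show "(\<lambda>r. compose (topspace X) r p) ` topspace P \<subseteq> extensional (topspace X)"
    by (auto simp: compose_def)
  show "continuous_map P X (\<lambda>r. compose (topspace X) r p x)" if x: "x \<in> topspace X" for x
    using continuous_eval[OF E_closed_pt[OF assms x]] by (simp only: compose_eq[OF x])
qed

lemma compose_tr: "p \<in> E \<Longrightarrow> compose (topspace X) (tr t) p = enveloping_action X \<pi> t p"
  unfolding enveloping_action_def compose_def
  by (rule restrict_ext) (simp add: E_closed_pt)

text \<open>Right composition with \<open>p\<close> is continuous and maps translations into
  \<open>E\<close> by invariance under the action; \<open>E\<close> is closed, so all of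
  \<open>E\<close> is mapped into \<open>E\<close>.\<close>

lemma E_compose: "r \<in> E \<Longrightarrow> p \<in> E \<Longrightarrow> compose (topspace X) r p \<in> E"
proof -
  assume r: "r \<in> E" and p: "p \<in> E"
  have "(\<lambda>r. compose (topspace X) r p) ` E
      \<subseteq> P closure_of ((\<lambda>r. compose (topspace X) r p) ` tr ` carrier T)"
    unfolding enveloping_semigroup_def
    by (rule continuous_map_image_closure_subset[OF
          continuous_precompose[OF p, unfolded enveloping_semigroup_def]])
  also have "\<dots> \<subseteq> E"
  proof (rule closure_of_minimal)
    show "(\<lambda>r. compose (topspace X) r p) ` tr ` carrier T \<subseteq> E"
      using p by (auto simp: compose_tr enveloping_action_in_E)
    show "closedin P E" by (simp add: enveloping_semigroup_def)
  qed
  finally show ?thesis using r by blast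
qed

section \<open>From proximality of \<open>X\<close> to proximality of \<open>E\<close>\<close>

text \<open>Otherwise the compact set of all \<open>(r x, r y)\<close> misses the diagonal, and its
  complement is a neighbourhood of the diagonal that no translate of \<open>(x, y)\<close>
  enters.\<close>

lemma proximal_pair_imp_identified:
  assumes xy: "x \<in> topspace X" "y \<in> topspace X" "proximal_pair T X \<pi> x y"
  obtains r where "r \<in> E" "r x = r y"
proof -
  let ?f = "\<lambda>r. (r x, r y)"
  let ?W = "topspace (prod_topology X X) - ?f ` E"
  have "continuous_map P (prod_topology X X) ?f"
    by (intro continuous_map_paired[THEN iffD2] conjI continuous_eval xy)
  then have "closedin (prod_topology X X) (?f ` E)"
    by (intro compactin_imp_closedin image_compactin[OF compactin_E])
      (simp add: Hausdorff_space_prod_topology Hausdorff_X)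
  then have "openin (prod_topology X X) ?W" by blast
  moreover have "(\<pi> t x, \<pi> t y) \<notin> ?W" if "t \<in> carrier T" for t
    using tr_in_E[OF that] xy(1,2) by (force simp: image_iff)
  ultimately obtain a where "a \<in> topspace X" "(a, a) \<notin> ?W"
    using xy(3) unfolding proximal_pair_iff_open[OF compact_X Hausdorff_X] by meson
  then show ?thesis using that by auto
qed

lemma proximal_imp_E_proximal:
  assumes "comm_group T" and prox: "proximal_flow T X \<pi>"
  shows "proximal_flow T (enveloping_space T X \<pi>) (enveloping_action X \<pi>)"
proof -
  interpret comm_group T by fact
  let ?fix = "\<lambda>t. {x \<in> topspace X. \<pi> t x = x}"
  have identify: "\<exists>r\<in>E. r x = r y" if "x \<in> topspace X" "y \<in> topspace X" for x y
    using prox that proximal_pair_imp_identified unfolding proximal_flow_def by metis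
  \<comment> \<open>Commutativity of \<open>T\<close> enters here: it gives the identity for
    translations, and both sides are continuous in \<open>r\<close>.\<close>
  have commute: "r (\<pi> t x) = \<pi> t (r x)"
    if "r \<in> E" and t: "t \<in> carrier T" and x: "x \<in> topspace X" for r t x
  proof (rule E_eqI[OF \<open>r \<in> E\<close>])
    show "continuous_map P X (\<lambda>r. r (\<pi> t x))"
      by (intro continuous_eval act_closed t x)
    show "continuous_map P X (\<lambda>r. \<pi> t (r x))"
      using continuous_map_compose[OF continuous_eval[OF x] continuous_act[OF t]]
      by (simp add: o_def)
    show "tr s (\<pi> t x) = \<pi> t (tr s x)" if "s \<in> carrier T" for s
      using act_mult[of s t x] act_mult[of t s x] that t x
      by (simp add: act_closed m_comm)
  qed
  have fix_finite: "\<exists>z\<in>topspace X. \<forall>t\<in>S. \<pi> t z = z"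
    if "finite S" "S \<subseteq> carrier T" "topspace X \<noteq> {}" for S
    using that
  proof (induction S)
    case empty
    then show ?case by blast
  next
    case (insert t S)
    then obtain z where z: "z \<in> topspace X" "\<forall>s\<in>S. \<pi> s z = z" by auto
    \<comment> \<open>Then \<open>r z\<close> is fixed by \<open>t\<close>, and it stays fixed by
      \<open>S\<close> because \<open>r\<close> commutes with the action.\<close>
    obtain r where r: "r \<in> E" "r z = r (\<pi> t z)"
      using identify[of z "\<pi> t z"] z insert.prems act_closed by auto
    have "\<pi> s (r z) = r z" if "s \<in> insert t S" for s
      using that commute[OF r(1), of s z] insert.prems z r(2) by auto
    then show ?case using E_closed_pt[OF r(1) z(1)] by blast
  qed
  have fixed: "\<exists>z\<in>topspace X. \<forall>t\<in>carrier T. \<pi> t z = z" if ne: "topspace X \<noteq> {}"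
  proof -
    have "\<exists>z\<in>topspace X. \<forall>t\<in>carrier T. z \<in> ?fix t"
    proof (rule compactin_finite_intersections)
      show "compactin X (topspace X)" using compact_X by (simp add: compact_space_def)
      show "closedin X (?fix t)" if "t \<in> carrier T" for t
        by (rule closedin_continuous_maps_eq[OF Hausdorff_X continuous_act[OF that]
              continuous_map_id[unfolded id_def]])
      show "\<exists>z\<in>topspace X. \<forall>t\<in>S. z \<in> ?fix t" if "finite S" "S \<subseteq> carrier T" for S
        using fix_finite[OF that ne] by blast
    qed
    then show ?thesis by blast
  qed
  have const: "(\<lambda>x\<in>topspace X. z) \<in> E"
    if z: "z \<in> topspace X" and fz: "\<forall>t\<in>carrier T. \<pi> t z = z" for z
  proof -
    have rz: "r z = z" if "r \<in> E" for r
      by (rule E_eqI[OF that]) (use z fz in \<open>auto intro: continuous_eval\<close>)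
    have finite_const: "\<exists>q\<in>E. \<forall>x\<in>F. q x = z" if "finite F" "F \<subseteq> topspace X" for F
      using that
    proof (induction F)
      case empty
      then show ?case using tr_in_E[OF one_closed] by blast
    next
      case (insert x F)
      then obtain q where q: "q \<in> E" "\<forall>y\<in>F. q y = z" by auto
      \<comment> \<open>As \<open>r z = z\<close>, composing with \<open>r\<close> sends
        \<open>x\<close> to \<open>z\<close> and keeps the points of \<open>F\<close> at
        \<open>z\<close>.\<close>
      obtain r where r: "r \<in> E" "r (q x) = r z"
        using identify[of "q x" z] E_closed_pt[OF q(1)] insert.prems z by auto
      have "compose (topspace X) r q y = z" if "y \<in> insert x F" for y
        using that r q rz insert.prems by (auto simp: compose_def)
      then show ?case using E_compose[OF r(1) q(1)] by blast
    qed
    let ?C = "\<lambda>x. {q \<in> topspace P. q x \<in> {z}}"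
    have "\<exists>q\<in>E. \<forall>x\<in>topspace X. q \<in> ?C x"
    proof (rule compactin_finite_intersections[OF compactin_E])
      show "closedin P (?C x)" if "x \<in> topspace X" for x
        by (rule closedin_continuous_map_preimage[OF continuous_eval[OF that]])
          (rule closedin_Hausdorff_singleton[OF Hausdorff_X z])
      show "\<exists>q\<in>E. \<forall>x\<in>F. q \<in> ?C x" if F: "finite F" "F \<subseteq> topspace X" for F
        using finite_const[OF F] E_subset by blast
    qed
    then obtain q where q: "q \<in> E" "\<forall>x\<in>topspace X. q x = z" by blast
    \<comment> \<open>Points of \<open>P\<close> are extensional, so agreement on the carrier
      suffices.\<close>
    then have "q = (\<lambda>x\<in>topspace X. z)"
      using E_subset by (intro extensionalityI[of _ "topspace X"]) (auto simp: PiE_def)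
    then show ?thesis using q(1) by simp
  qed
  have cE: "compact_space (enveloping_space T X \<pi>)" "Hausdorff_space (enveloping_space T X \<pi>)"
    using flow_E by (simp_all add: flow_def)
  show ?thesis
    unfolding proximal_flow_def proximal_pair_iff_open[OF cE] topspace_enveloping
  proof (intro ballI allI impI)
    fix p q W
    assume pq: "p \<in> E" "q \<in> E"
      and W: "openin (prod_topology (enveloping_space T X \<pi>) (enveloping_space T X \<pi>)) W"
        "\<forall>a\<in>E. (a, a) \<in> W"
    let ?f = "\<lambda>r. (compose (topspace X) r p, compose (topspace X) r q)"
    have "\<exists>c\<in>E. compose (topspace X) c p = compose (topspace X) c q"
    proof (cases "topspace X = {}")
      case True
      \<comment> \<open>Over an empty carrier all composites are the same function, so any element
        of \<open>E\<close> serves.\<close>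
      then show ?thesis using pq by (intro bexI[of _ p]) (auto simp: compose_def restrict_def fun_eq_iff)
    next
      case False
      then obtain z where "z \<in> topspace X" "\<forall>t\<in>carrier T. \<pi> t z = z" using fixed by blast
      from const[OF this] show ?thesis
        by (rule rev_bexI) (auto simp: compose_def E_closed_pt pq)
    qed
    then obtain c where c: "c \<in> E" "compose (topspace X) c p = compose (topspace X) c q" by blast
    \<comment> \<open>\<open>W\<close> is open only relative to \<open>E\<close>; density of the
      translations is applied to an open set of the ambient product.\<close>
    obtain W' where W': "openin (prod_topology P P) W'" "W = W' \<inter> (E \<times> E)"
      using W(1) unfolding enveloping_space_def subtopology_Times[symmetric] openin_subtopology
      by blast
    have cont: "continuous_map P (prod_topology P P) ?f"
      by (intro continuous_map_paired[THEN iffD2] conjI continuous_precompose pq)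
    \<comment> \<open>\<open>c\<close> identifies \<open>p\<close> and \<open>q\<close>, so
      \<open>?f c\<close> is on the diagonal; a translation close to \<open>c\<close> then brings
      them \<open>W\<close>-close.\<close>
    have "?f c \<in> W'" using W(2) W'(2) E_compose[OF c(1) pq(2)] c(2) by auto
    then obtain t where t: "t \<in> carrier T" "?f (tr t) \<in> W'"
      using E_meets_open[OF c(1) cont W'(1)] by blast
    then show "\<exists>t\<in>carrier T. (enveloping_action X \<pi> t p, enveloping_action X \<pi> t q) \<in> W"
      using W'(2) pq by (intro bexI[of _ t]) (simp_all add: compose_tr enveloping_action_in_E)
  qed
qed

section \<open>From proximality of \<open>E\<close> to proximality of \<open>X\<close>\<close>

lemma E_proximal_imp_proximal:
  assumes trans: "point_transitive T X \<pi>"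
    and prox: "proximal_flow T (enveloping_space T X \<pi>) (enveloping_action X \<pi>)"
  shows "proximal_flow T X \<pi>"
  unfolding proximal_flow_def proximal_pair_iff_open[OF compact_X Hausdorff_X]
proof (intro ballI allI impI)
  fix y y' W
  assume y: "y \<in> topspace X" "y' \<in> topspace X"
    and W: "openin (prod_topology X X) W" "\<forall>a\<in>topspace X. (a, a) \<in> W"
  let ?Y = "enveloping_space T X \<pi>"
  \<comment> \<open>A dense orbit makes evaluation at \<open>x\<close> surjective, so
    \<open>y\<close> and \<open>y'\<close> lift to \<open>E\<close>.\<close>
  obtain x where x: "x \<in> topspace X" "(\<lambda>r. r x) ` E = topspace X"
    using trans eval_E unfolding point_transitive_def by metis
  obtain p q where pq: "p \<in> E" "p x = y" "q \<in> E" "q x = y'"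
    using y unfolding x(2)[symmetric] by blast
  let ?g = "\<lambda>(p, q). (p x, q x)"
  \<comment> \<open>Pulling \<open>W\<close> back along evaluation gives a neighbourhood of the
    diagonal for the lifted pair.\<close>
  let ?V = "{a \<in> topspace (prod_topology ?Y ?Y). ?g a \<in> W}"
  have ev: "continuous_map ?Y X (\<lambda>r. r x)"
    unfolding enveloping_space_def
    by (intro continuous_map_from_subtopology continuous_eval x)
  then have "continuous_map (prod_topology ?Y ?Y) (prod_topology X X) ?g"
    using x(1) by (intro continuous_map_prod_top[THEN iffD2]) blast
  then have V: "openin (prod_topology ?Y ?Y) ?V"
    using W(1) by (rule openin_continuous_map_preimage)
  have diag: "\<forall>a\<in>topspace ?Y. (a, a) \<in> ?V"
    using W(2) x(1) by (auto simp: topspace_enveloping E_closed_pt)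
  have "compact_space ?Y" "Hausdorff_space ?Y" using flow_E by (simp_all add: flow_def)
  moreover have "proximal_pair T ?Y (enveloping_action X \<pi>) p q"
    using prox pq(1,3) unfolding proximal_flow_def topspace_enveloping by blast
  ultimately have "\<exists>t\<in>carrier T. (enveloping_action X \<pi> t p, enveloping_action X \<pi> t q) \<in> ?V"
    using V diag by (rule proximal_pair_iff_open[THEN iffD1, THEN spec, THEN mp, THEN mp])
  then obtain t where t: "t \<in> carrier T"
    and "(enveloping_action X \<pi> t p, enveloping_action X \<pi> t q) \<in> ?V"
    by blast
  then have "(enveloping_action X \<pi> t p x, enveloping_action X \<pi> t q x) \<in> W"
    by (simp only: mem_Collect_eq prod.case)
  \<comment> \<open>Evaluation is equivariant: acting by \<open>t\<close> on \<open>p\<close> and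
    then evaluating at \<open>x\<close> gives \<open>\<pi> t (p x)\<close>.\<close>
  then have "(\<pi> t y, \<pi> t y') \<in> W"
    by (simp only: enveloping_action_def compose_eq[OF x(1)] pq)
  with t show "\<exists>t\<in>carrier T. (\<pi> t y, \<pi> t y') \<in> W" by blast
qed

end

theorem theorem15:
  fixes T :: "('t, 'm) monoid_scheme" and \<tau> :: "'t topology"
    and X :: "'a topology" and \<pi> :: "'t \<Rightarrow> 'a \<Rightarrow> 'a"
  assumes flow: "flow T \<tau> X \<pi>"
    and no_isolated_points: "\<And>x. x \<in> topspace X \<Longrightarrow> \<not> openin X {x}"
    and abelian: "comm_group T"
  shows "(proximal_flow T X \<pi> \<longrightarrow>
            proximal_flow T (enveloping_space T X \<pi>) (enveloping_action X \<pi>)) \<and>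
         (point_transitive T X \<pi> \<longrightarrow>
            proximal_flow T (enveloping_space T X \<pi>) (enveloping_action X \<pi>) \<longrightarrow>
            proximal_flow T X \<pi>)"
proof -
  interpret topological_flow T \<tau> X \<pi> by (rule topological_flow.intro[OF flow])
  show ?thesis using proximal_imp_E_proximal[OF abelian] E_proximal_imp_proximal by blast
qed

end
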